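(* Let $q$ be a prime power, $m\ge1$, $1\le k\le q-1$, and let $d=q+1-k$ be the minimum distance of $\mathrm{PRS}_q(k)$. Put $\theta_{m,q}=\frac{q^{m+1}-1}{q-1}$. Then the minimum distance $D$ of $\mathrm{PLift}_q(m,k)$ satisfies $$D\le\theta_{m,q}-q^{m-1}(q+1-d).$$ As a consequence, the relative distances $\delta=d/(q+1)$ of $\mathrm{PRS}_q(k)$ and $\Delta=D/\theta_{m,q}$ of $\mathrm{PLift}_q(m,k)$ satisfy $\Delta\le(1-b)\delta+b$ for some $b$ with $0\le b\le q^{-2}$.
   Context: $\mathbb P^m=(\mathbb F_q^{m+1}\setminus\{0\})/\mathbb F_q^\times$; the standard representative of a point is the one whose leftmost non-zero coordinate is $1$. $\mathbb F_q[\mathbf X]^H_v$ is the space of homogeneous polynomials of degree $v$ in $X_0,\dots,X_m$ (together with $0$), and $\mathrm{ev}_{\mathbb P^m}(f)=(f(\mathbf P))_{\mathbf P\in\mathbb P^m}$, evaluating at standard representatives. $\mathrm{PRS}_q(k)=\{\mathrm{ev}_{\mathbb P^1}(g): g\in\mathbb F_q[S,T]^H_k\}$, a code of length $q+1$ and dimension $k+1$. $\mathrm{Emb}_{\mathbb P}(m)$ is the set of injective $\mathbb F_q$-linear maps $L:\mathbb F_q^2\to\mathbb F_q^{m+1}$, and $f\circ L=f(L(S,T))$. For $v=k+(m-1)(q-1)$, $$\mathrm{PLift}_q(m,k)=\{\mathrm{ev}_{\mathbb P^m}(f): f\in\mathbb F_q[\mathbf X]^H_v,\ \forall L\in\mathrm{Emb}_{\mathbb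 P}(m),\ \mathrm{ev}_{\mathbb P^1}(f\circ L)\in\mathrm{PRS}_q(k)\},$$ a code of length $\theta_{m,q}=|\mathbb P^m|$. Distances are with respect to the Hamming metric; the relative distance is the minimum distance divided by the length. *)

theory Defs
  imports "HOL-Analysis.Analysis" "HOL-Library.Poly_Mapping"
begin

type_synonym ('x, 'a) mpoly = "('x \<Rightarrow>\<^sub>0 nat) \<Rightarrow>\<^sub>0 'a"

definition mpoly_const :: "'a \<Rightarrow> ('x, 'a::zero) mpoly" where
  "mpoly_const c = Poly_Mapping.single 0 c"

definition mpoly_var :: "'x \<Rightarrow> ('x, 'a::zero_neq_one) mpoly" where
  "mpoly_var i = Poly_Mapping.single (Poly_Mapping.single i 1) 1"

text \<open>Substitution of the values \<open>x\<close> for the variables, the coefficients being mapped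
  into the target ring by \<open>h\<close>.\<close>

definition mpoly_subst :: "('a \<Rightarrow> 'b) \<Rightarrow> ('x::finite \<Rightarrow> 'b) \<Rightarrow> ('x, 'a::zero) mpoly \<Rightarrow> 'b::comm_semiring_1" where
  "mpoly_subst h x f =
     (\<Sum>\<mu>\<in>Poly_Mapping.keys f.
        h (Poly_Mapping.lookup f \<mu>) * (\<Prod>i\<in>UNIV. x i ^ Poly_Mapping.lookup \<mu> i))"

definition mpoly_eval :: "('x::finite, 'a::comm_semiring_1) mpoly \<Rightarrow> 'a ^ 'x \<Rightarrow> 'a" where
  "mpoly_eval f x = mpoly_subst (\<lambda>c. c) (\<lambda>i. x $ i) f"

definition homogeneous_polys :: "nat \<Rightarrow> ('x::finite, 'a::zero) mpoly set" where
  "homogeneous_polys v =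
     {f. \<forall>\<mu>\<in>Poly_Mapping.keys f. (\<Sum>i\<in>UNIV. Poly_Mapping.lookup \<mu> i) = v}"

text \<open>The polynomial \<open>f(L(X))\<close>: the variable with index \<open>i\<close> is replaced by the linear form
  giving the coordinate \<open>i\<close> of \<open>L\<close>.\<close>

definition mpoly_comp_linear ::
    "('x::finite, 'a::comm_ring_1) mpoly \<Rightarrow> ('a ^ 'y::finite \<Rightarrow> 'a ^ 'x) \<Rightarrow> ('y, 'a) mpoly" where
  "mpoly_comp_linear f L =
     mpoly_subst mpoly_const (\<lambda>i. \<Sum>j\<in>UNIV. mpoly_const (matrix L $ i $ j) * mpoly_var j) f"

text \<open>The projective space of \<open>'a ^ 'x\<close>; its dimension is \<open>CARD('x) - 1\<close>.\<close>

definition proj_space :: "('a::field ^ 'x::finite) set set" where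
  "proj_space = (UNIV - {0}) // {(x, y). x \<noteq> 0 \<and> (\<exists>c. c \<noteq> 0 \<and> y = c *s x)}"

definition std_rep :: "('a::field ^ 'x::{finite,linorder}) set \<Rightarrow> 'a ^ 'x::{finite,linorder}" where
  "std_rep P = (THE x. x \<in> P \<and> (\<exists>i. x $ i = 1 \<and> (\<forall>j<i. x $ j = 0)))"

definition ev_proj ::
    "('x::{finite,linorder}, 'a::field) mpoly \<Rightarrow> ('a ^ 'x::{finite,linorder}) set \<Rightarrow> 'a" where
  "ev_proj f = (\<lambda>P\<in>proj_space. mpoly_eval f (std_rep P))"

text \<open>The two variables \<open>S\<close>, \<open>T\<close> are indexed by \<open>0 < 1\<close> of the numeral type \<open>2\<close>.\<close>

definition PRS :: "nat \<Rightarrow> (('a::field ^ 2) set \<Rightarrow> 'a) set" where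
  "PRS k = {ev_proj g | g. g \<in> homogeneous_polys k}"

definition Emb_proj :: "('a::field ^ 2 \<Rightarrow> 'a ^ 'x::finite) set" where
  "Emb_proj = {L. Vector_Spaces.linear (*s) (*s) L \<and> inj L}"

definition PLift :: "nat \<Rightarrow> (('a::{field,finite} ^ 'x::{finite,linorder}) set \<Rightarrow> 'a) set" where
  "PLift k =
     (let q = CARD('a); m = CARD('x) - 1; v = k + (m - 1) * (q - 1)
      in {ev_proj f | f. f \<in> homogeneous_polys v \<and>
            (\<forall>L \<in> (Emb_proj :: ('a ^ 2 \<Rightarrow> 'a ^ 'x::{finite,linorder}) set). ev_proj (mpoly_comp_linear f L) \<in> PRS k)})"

text \<open>Codes are sets of words indexed by a finite set \<open>I\<close> of positions.\<close>

definition hamming_dist :: "'i set \<Rightarrow> ('i \<Rightarrow> 'a) \<Rightarrow> ('i \<Rightarrow> 'a) \<Rightarrow> nat" where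
  "hamming_dist I c c' = card {i \<in> I. c i \<noteq> c' i}"

definition min_distance :: "'i set \<Rightarrow> ('i \<Rightarrow> 'a) set \<Rightarrow> nat" where
  "min_distance I C = Min {hamming_dist I c c' | c c'. c \<in> C \<and> c' \<in> C \<and> c \<noteq> c'}"

definition relative_distance :: "'i set \<Rightarrow> ('i \<Rightarrow> 'a) set \<Rightarrow> real" where
  "relative_distance I C = real (min_distance I C) / real (card I)"

end

theory Submission
  imports Defs
begin

text \<open>Let \<open>i\<close> be the first coordinate, \<open>j\<close> another one, and \<open>A\<close> a set of \<open>k - 1\<close> field elements.
  The form \<open>X\<^sub>i\<^bsup>n\<^esup> \<Prod>\<^bsub>a\<in>A\<^esub> (X\<^sub>j - a X\<^sub>i)\<close> with \<open>n = (m - 1)(q - 1) + 1\<close> has degree \<open>v\<close>. Since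
  \<open>x\<^bsup>n\<^esup> = x\<close> on the field, its restriction to a line agrees as a function with a binary form of degree
  \<open>k\<close>, so it defines a word of the lift; the extra factor \<open>X\<^sub>i\<close>, in place of a \<open>k\<close>-th factor
  \<open>X\<^sub>j - a X\<^sub>i\<close>, is what makes this true on lines meeting the hyperplane \<open>X\<^sub>i = 0\<close> in one point.
  The word vanishes on that hyperplane and on \<open>(k - 1) q\<^bsup>m-1\<^esup>\<close> further points, whence
  \<open>D \<le> d q\<^bsup>m-1\<^esup>\<close>. As \<open>\<theta> \<ge> (q + 1) q\<^bsup>m-1\<^esup>\<close>, this is stronger than the claimed bound and gives
  \<open>\<Delta> \<le> \<delta>\<close>, so that \<open>b = 0\<close> serves. The case \<open>m = 1\<close> of the same word shows
  \<open>d \<le> q + 1 - k\<close>.\<close>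

section \<open>Evaluation of polynomials as a ring homomorphism\<close>

lemma mpoly_eval_superset:
  assumes "finite K" "Poly_Mapping.keys f \<subseteq> K"
  shows "mpoly_eval f x =
    (\<Sum>\<mu>\<in>K. Poly_Mapping.lookup f \<mu> * (\<Prod>i\<in>UNIV. x $ i ^ Poly_Mapping.lookup \<mu> i))"
  unfolding mpoly_eval_def mpoly_subst_def
  using assms by (intro sum.mono_neutral_left) (auto simp: in_keys_iff)

lemma mpoly_eval_0 [simp]: "mpoly_eval 0 x = 0"
  by (simp add: mpoly_eval_def mpoly_subst_def)

lemma mpoly_eval_single:
  "mpoly_eval (Poly_Mapping.single \<mu> c) x = c * (\<Prod>i\<in>UNIV. x $ i ^ Poly_Mapping.lookup \<mu> i)"
  by (subst mpoly_eval_superset[where K = "{\<mu>}"]) auto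

lemma mpoly_eval_add: "mpoly_eval (f + g) x = mpoly_eval f x + mpoly_eval g x"
proof -
  let ?K = "Poly_Mapping.keys f \<union> Poly_Mapping.keys g"
  have "Poly_Mapping.keys (f + g) \<subseteq> ?K" by (rule keys_add)
  then show ?thesis
    by (simp add: mpoly_eval_superset[where K = ?K] lookup_add algebra_simps sum.distrib)
qed

lemma mpoly_eval_diff:
  fixes f g :: "('x::finite, 'a::comm_ring_1) mpoly"
  shows "mpoly_eval (f - g) x = mpoly_eval f x - mpoly_eval g x"
  using mpoly_eval_add[of "f - g" g x] by simp

lemma mpoly_eval_sum: "mpoly_eval (sum F A) x = (\<Sum>a\<in>A. mpoly_eval (F a) x)"
  by (induction A rule: infinite_finite_induct) (auto simp: mpoly_eval_add)

lemma mpoly_sum_single: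
  fixes f :: "'b \<Rightarrow>\<^sub>0 'a::comm_monoid_add"
  shows "f = (\<Sum>\<mu>\<in>Poly_Mapping.keys f. Poly_Mapping.single \<mu> (Poly_Mapping.lookup f \<mu>))"
proof (rule poly_mapping_eqI)
  fix \<nu>
  show "Poly_Mapping.lookup f \<nu> = Poly_Mapping.lookup
      (\<Sum>\<mu>\<in>Poly_Mapping.keys f. Poly_Mapping.single \<mu> (Poly_Mapping.lookup f \<mu>)) \<nu>"
    by (simp add: lookup_sum lookup_single when_def in_keys_iff)
qed

text \<open>Both factors are expanded into monomials; for single monomials exponents add under
  multiplication, and distributivity does the rest.\<close>

lemma mpoly_eval_mult: "mpoly_eval (f * g) x = mpoly_eval f x * mpoly_eval g x"
proof -
  let ?s = "\<lambda>h \<mu>. Poly_Mapping.single \<mu> (Poly_Mapping.lookup h \<mu>)"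
  have "f * g = (\<Sum>\<mu>\<in>Poly_Mapping.keys f. ?s f \<mu>) * (\<Sum>\<nu>\<in>Poly_Mapping.keys g. ?s g \<nu>)"
    using mpoly_sum_single[of f] mpoly_sum_single[of g] by simp
  also have "\<dots> = (\<Sum>\<mu>\<in>Poly_Mapping.keys f. \<Sum>\<nu>\<in>Poly_Mapping.keys g. ?s f \<mu> * ?s g \<nu>)"
    by (simp add: sum_product)
  finally have "mpoly_eval (f * g) x =
      (\<Sum>\<mu>\<in>Poly_Mapping.keys f. \<Sum>\<nu>\<in>Poly_Mapping.keys g. mpoly_eval (?s f \<mu>) x * mpoly_eval (?s g \<nu>) x)"
    by (simp add: mpoly_eval_sum mult_single mpoly_eval_single lookup_add power_add prod.distrib mult_ac)
  also have "\<dots> = mpoly_eval f x * mpoly_eval g x"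
    unfolding mpoly_eval_single by (simp add: mpoly_eval_def mpoly_subst_def sum_product)
  finally show ?thesis .
qed

lemma mpoly_eval_const [simp]: "mpoly_eval (mpoly_const c) x = c"
  by (simp add: mpoly_const_def mpoly_eval_single)

lemma mpoly_eval_var [simp]: "mpoly_eval (mpoly_var i) x = x $ i"
proof -
  have "(\<Prod>j\<in>UNIV. x $ j ^ Poly_Mapping.lookup (Poly_Mapping.single i 1) j) =
      (\<Prod>j\<in>UNIV. if j = i then x $ j else 1)"
    by (intro prod.cong) (auto simp: lookup_single when_def)
  then show ?thesis by (simp add: mpoly_var_def mpoly_eval_single)
qed

lemma mpoly_eval_1 [simp]: "mpoly_eval 1 x = 1"
  using mpoly_eval_const[of 1 x] by (simp add: mpoly_const_def)

lemma mpoly_eval_prod: "mpoly_eval (prod F A) x = (\<Prod>a\<in>A. mpoly_eval (F a) x)"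
  by (induction A rule: infinite_finite_induct) (auto simp: mpoly_eval_mult)

lemma mpoly_eval_power: "mpoly_eval (f ^ n) x = mpoly_eval f x ^ n"
  by (induction n) (auto simp: mpoly_eval_mult)

lemmas mpoly_eval_hom =
  mpoly_eval_add mpoly_eval_diff mpoly_eval_mult mpoly_eval_sum mpoly_eval_prod mpoly_eval_power

text \<open>Evaluation is a ring homomorphism, so the formal substitution of linear forms becomes
  the matrix product giving the coordinates of \<open>L y\<close>. Restrictions to lines can then be
  compared pointwise.\<close>

lemma mpoly_eval_comp_linear:
  assumes "Vector_Spaces.linear (*s) (*s) L"
  shows "mpoly_eval (mpoly_comp_linear f L) y = mpoly_eval f (L y)"
proof -
  have L: "(\<Sum>j\<in>UNIV. matrix L $ i $ j * y $ j) = L y $ i" for i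
    using matrix_works[OF assms, of y]
    by (metis (no_types, lifting) matrix_vector_mult_def sum.cong vec_lambda_beta)
  show ?thesis
    by (simp add: mpoly_comp_linear_def mpoly_subst_def mpoly_eval_hom L)
       (simp add: mpoly_eval_def mpoly_subst_def)
qed

section \<open>Closure properties of homogeneous polynomials\<close>

lemma homogeneous_polys_0 [simp]: "0 \<in> homogeneous_polys v"
  by (simp add: homogeneous_polys_def)

lemma homogeneous_polys_add:
  "f \<in> homogeneous_polys v \<Longrightarrow> g \<in> homogeneous_polys v \<Longrightarrow> f + g \<in> homogeneous_polys v"
  using keys_add[of f g] by (auto simp: homogeneous_polys_def)

lemma homogeneous_polys_diff:
  fixes f g :: "('x::finite, 'a::comm_ring_1) mpoly"
  shows "f \<in> homogeneous_polys v \<Longrightarrow> g \<in> homogeneous_polys v \<Longrightarrow> f - g \<in> homogeneous_polys v"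
  using keys_diff[of f g] by (auto simp: homogeneous_polys_def)

lemma homogeneous_polys_sum:
  "(\<And>a. a \<in> A \<Longrightarrow> F a \<in> homogeneous_polys v) \<Longrightarrow> sum F A \<in> homogeneous_polys v"
  by (induction A rule: infinite_finite_induct) (auto simp: homogeneous_polys_add)

lemma homogeneous_polys_mult:
  assumes "f \<in> homogeneous_polys u" "g \<in> homogeneous_polys v"
  shows "f * g \<in> homogeneous_polys (u + v)"
proof -
  have "(\<Sum>i\<in>UNIV. Poly_Mapping.lookup \<mu> i) = u + v" if \<mu>: "\<mu> \<in> Poly_Mapping.keys (f * g)" for \<mu>
  proof -
    obtain a b where "\<mu> = a + b" "a \<in> Poly_Mapping.keys f" "b \<in> Poly_Mapping.keys g"
      using keys_mult[of f g] \<mu> by blast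
    then show ?thesis
      using assms by (simp add: homogeneous_polys_def lookup_add sum.distrib)
  qed
  then show ?thesis by (simp add: homogeneous_polys_def)
qed

lemma homogeneous_polys_1: "1 \<in> homogeneous_polys 0"
  by (simp add: homogeneous_polys_def)

lemma homogeneous_polys_prod:
  "finite A \<Longrightarrow> (\<And>a. a \<in> A \<Longrightarrow> F a \<in> homogeneous_polys 1) \<Longrightarrow> prod F A \<in> homogeneous_polys (card A)"
  by (induction A rule: finite_induct)
     (use homogeneous_polys_1 homogeneous_polys_mult[where u = 1] in fastforce)+

lemma homogeneous_polys_power:
  "f \<in> homogeneous_polys 1 \<Longrightarrow> f ^ n \<in> homogeneous_polys n"
  by (induction n) (use homogeneous_polys_1 homogeneous_polys_mult[where u = 1] in fastforce)+

lemma homogeneous_polys_const_mult: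
  "f \<in> homogeneous_polys v \<Longrightarrow> mpoly_const c * f \<in> homogeneous_polys v"
  using homogeneous_polys_mult[of "mpoly_const c" 0 f v]
  by (auto simp: homogeneous_polys_def mpoly_const_def split: if_splits)

lemma homogeneous_polys_var: "mpoly_var i \<in> homogeneous_polys 1"
  by (auto simp: homogeneous_polys_def mpoly_var_def lookup_single when_def)

text \<open>Multiplication by \<open>x\<close> permutes the nonzero elements, so their product is
  unchanged when each factor is multiplied by \<open>x\<close>; that product is nonzero and
  cancels.\<close>

lemma finite_field_power_card_minus_1:
  fixes x :: "'a::{field,finite}"
  assumes "x \<noteq> 0"
  shows "x ^ (CARD('a) - 1) = 1"
proof -
  have "x ^ (CARD('a) - 1) * \<Prod>(UNIV - {0}) = (\<Prod>y\<in>UNIV-{0}. x * y)"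
    by (simp add: prod.distrib)
  also have "\<dots> = \<Prod>(UNIV - {0})"
    by (rule prod.reindex_bij_witness[of _ "\<lambda>y. y / x" "\<lambda>y. x * y"]) (use assms in auto)
  finally show ?thesis by simp
qed

section \<open>Projective points and their standard representatives\<close>

definition proj_point :: "'a::field ^ 'x::finite \<Rightarrow> ('a ^ 'x) set" where
  "proj_point x = {c *s x | c. c \<noteq> 0}"

lemma proj_space_eq_image: "proj_space = proj_point ` (UNIV - {0})"
  by (auto simp: proj_space_def quotient_def proj_point_def Image_def)

lemma proj_point_eq:
  assumes "y \<in> proj_point x"
  shows "proj_point y = proj_point x"
proof -
  obtain c where c: "c \<noteq> 0" "y = c *s x" using assms by (auto simp: proj_point_def)
  have "a *s x = (a / c) *s y" for a using c by (simp add: vec_eq_iff)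
  then have "\<exists>b. b \<noteq> 0 \<and> a *s x = b *s y" if "a \<noteq> 0" for a
    using c that by (metis divide_eq_0_iff)
  moreover have "\<exists>b. b \<noteq> 0 \<and> a *s y = b *s x" if "a \<noteq> 0" for a
    using c that by (intro exI[of _ "a * c"]) simp
  ultimately show ?thesis
    unfolding proj_point_def by blast
qed

lemma self_mem_proj_point: "x \<in> proj_point x"
  unfolding proj_point_def by (rule CollectI, rule exI[of _ 1]) auto

lemma card_proj_point:
  fixes x :: "'a::{field,finite} ^ 'x::finite"
  assumes "x \<noteq> 0"
  shows "card (proj_point x) = CARD('a) - 1"
proof -
  have "inj_on (\<lambda>c. c *s x) (UNIV - {0})"
    using assms by (intro inj_onI) simp
  moreover have "proj_point x = (\<lambda>c. c *s x) ` (UNIV - {0})"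
    by (auto simp: proj_point_def)
  ultimately show ?thesis by (simp add: card_image card_Diff_subset)
qed

text \<open>The points partition the nonzero vectors into blocks of size
  \<open>CARD('a) - 1\<close>. The product form avoids a division of natural numbers.\<close>

lemma card_proj_space:
  "(CARD('a) - 1) * card (proj_space :: ('a::{field,finite} ^ 'x::finite) set set) =
    CARD('a) ^ CARD('x) - 1"
proof -
  let ?P = "proj_space :: ('a ^ 'x) set set"
  have "(CARD('a) - 1) * card ?P = card (\<Union> ?P)"
  proof (rule card_partition)
    show "card P = CARD('a) - 1" if "P \<in> ?P" for P
      using that card_proj_point unfolding proj_space_eq_image by blast
    show "P \<inter> Q = {}" if "P \<in> ?P" "Q \<in> ?P" "P \<noteq> Q" for P Q
      using that proj_point_eq unfolding proj_space_eq_image by blast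
  qed (rule finite)+
  also have "\<Union> ?P = UNIV - {0}"
  proof
    show "\<Union> ?P \<subseteq> UNIV - {0}"
      unfolding proj_space_eq_image by (auto simp: proj_point_def)
    show "UNIV - {0} \<subseteq> \<Union> ?P"
      unfolding proj_space_eq_image using self_mem_proj_point by blast
  qed
  also have "card (UNIV - {0 :: 'a ^ 'x}) = CARD('a) ^ CARD('x) - 1"
    by (subst card_Diff_subset) (simp_all only: finite CARD_vec card.insert card.empty, auto)
  finally show ?thesis .
qed

definition proj_normalized :: "('a::field ^ 'x::{finite,linorder}) set" where
  "proj_normalized = {x. \<exists>i. x $ i = 1 \<and> (\<forall>j<i. x $ j = 0)}"

text \<open>Scaling keeps the position of the leading coordinate, so two normalized vectors in one
  class have it at the same index, and the scalar between them is 1.\<close>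

lemma std_rep_proj_point:
  assumes "x \<in> proj_normalized"
  shows "std_rep (proj_point x) = x"
  unfolding std_rep_def
proof (rule the_equality)
  show "x \<in> proj_point x \<and> (\<exists>i. x $ i = 1 \<and> (\<forall>j<i. x $ j = 0))"
    using assms self_mem_proj_point by (auto simp: proj_normalized_def)
next
  fix y assume y: "y \<in> proj_point x \<and> (\<exists>i. y $ i = 1 \<and> (\<forall>j<i. y $ j = 0))"
  then obtain c i where c: "c \<noteq> 0" "y = c *s x" and i: "c * x $ i = 1" "\<forall>j<i. c * x $ j = 0"
    by (auto simp: proj_point_def)
  obtain i' where i': "x $ i' = 1" "\<forall>j<i'. x $ j = 0"
    using assms by (auto simp: proj_normalized_def)
  have "i = i'"
    using c i i' by (metis linorder_neqE mult_eq_0_iff zero_neq_one)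
  then show "y = x" using c i i' by simp
qed

lemma proj_normalized_scaled:
  fixes x :: "'a::field ^ 'x::{finite,linorder}"
  assumes "x \<noteq> 0"
  obtains c where "c \<noteq> 0" "c *s x \<in> proj_normalized"
proof -
  define i where "i = Min {i. x $ i \<noteq> 0}"
  have ne: "{i. x $ i \<noteq> 0} \<noteq> {}" using assms by (auto simp: vec_eq_iff)
  have i: "x $ i \<noteq> 0" using Min_in[OF _ ne] by (simp add: i_def)
  have "x $ j = 0" if "j < i" for j
    using that Min_le[of "{i. x $ i \<noteq> 0}" j] unfolding i_def by (auto simp: not_less[symmetric])
  then have "inverse (x $ i) *s x \<in> proj_normalized"
    using i by (auto simp: proj_normalized_def intro!: exI[of _ i])
  then show ?thesis using that i by (metis nonzero_imp_inverse_nonzero)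
qed

lemma proj_normalized_nonzero: "x \<in> proj_normalized \<Longrightarrow> x \<noteq> 0"
  by (auto simp: proj_normalized_def)

text \<open>Words indexed by equivalence classes can thereby be compared and counted over normalized
  vectors.\<close>

lemma bij_betw_std_rep:
  "bij_betw std_rep (proj_space :: ('a::field ^ 'x::{finite,linorder}) set set) proj_normalized"
proof (rule bij_betw_byWitness[where f' = proj_point])
  have *: "\<exists>x\<in>proj_normalized. P = proj_point x" if P: "P \<in> proj_space" for P :: "('a, 'x) vec set"
  proof -
    obtain x where x: "x \<noteq> 0" "P = proj_point x"
      using P by (auto simp: proj_space_eq_image)
    obtain c where c: "c \<noteq> 0" "c *s x \<in> proj_normalized"
      using proj_normalized_scaled[OF x(1)] by blast
    have "c *s x \<in> proj_point x" using c by (auto simp: proj_point_def)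
    then show ?thesis using proj_point_eq x(2) c(2) by blast
  qed
  show "\<forall>P\<in>proj_space. proj_point (std_rep P) = (P :: ('a, 'x) vec set)"
    using * std_rep_proj_point by fastforce
  show "std_rep ` proj_space \<subseteq> (proj_normalized :: ('a, 'x) vec set)"
    using * std_rep_proj_point by fastforce
  show "proj_point ` proj_normalized \<subseteq> (proj_space :: ('a, 'x) vec set set)"
    using proj_normalized_nonzero by (auto simp: proj_space_eq_image)
qed (simp add: std_rep_proj_point)

lemma std_rep_image: "std_rep ` proj_space = proj_normalized"
  using bij_betw_std_rep by (rule bij_betw_imp_surj_on)

lemma ev_proj_eq_iff:
  "ev_proj f = ev_proj g \<longleftrightarrow> (\<forall>x\<in>proj_normalized. mpoly_eval f x = mpoly_eval g x)"
proof -
  have "ev_proj f = ev_proj g \<longleftrightarrow>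
      (\<forall>P\<in>proj_space. mpoly_eval f (std_rep P) = mpoly_eval g (std_rep P))"
    by (auto simp: ev_proj_def fun_eq_iff restrict_def)
  then show ?thesis
    by (simp only: std_rep_image[symmetric] ball_simps)
qed

section \<open>Hamming distance and minimum distance\<close>

lemma hamming_dist_ev_proj:
  "hamming_dist proj_space (ev_proj f) (ev_proj g) =
    card {x \<in> proj_normalized. mpoly_eval f x \<noteq> mpoly_eval g x}"
proof -
  let ?S = "{P \<in> proj_space. ev_proj f P \<noteq> ev_proj g P}"
  have "std_rep ` ?S = {x \<in> proj_normalized. mpoly_eval f x \<noteq> mpoly_eval g x}"
    unfolding std_rep_image[symmetric] ev_proj_def by auto
  moreover have "inj_on std_rep ?S"
    using bij_betw_imp_inj_on[OF bij_betw_std_rep] by (rule inj_on_subset) blast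
  then have "card (std_rep ` ?S) = card ?S" by (rule card_image)
  ultimately show ?thesis unfolding hamming_dist_def by simp
qed

lemma finite_hamming_dists:
  assumes "finite I"
  shows "finite {hamming_dist I c c' | c c'. c \<in> C \<and> c' \<in> C \<and> c \<noteq> c'}"
proof (rule finite_subset)
  show "{hamming_dist I c c' | c c'. c \<in> C \<and> c' \<in> C \<and> c \<noteq> c'} \<subseteq> {..card I}"
    using assms by (auto simp: hamming_dist_def intro!: card_mono)
qed simp

lemma min_distance_le:
  assumes "finite I" "c \<in> C" "c' \<in> C" "c \<noteq> c'"
  shows "min_distance I C \<le> hamming_dist I c c'"
  unfolding min_distance_def using assms
  by (intro Min_le finite_hamming_dists) auto

text \<open>The two distinct words guarantee that \<open>Min\<close> is taken over a nonempty
  set.\<close>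

lemma min_distance_ge:
  assumes "finite I" "c \<in> C" "c' \<in> C" "c \<noteq> c'"
    and "\<And>c c'. c \<in> C \<Longrightarrow> c' \<in> C \<Longrightarrow> c \<noteq> c' \<Longrightarrow> n \<le> hamming_dist I c c'"
  shows "n \<le> min_distance I C"
  unfolding min_distance_def
  by (rule Min.boundedI) (use assms in \<open>auto intro: finite_hamming_dists\<close>)

section \<open>A low-weight word of the lifted code\<close>

text \<open>The exponent \<open>n\<close> stays a parameter: \<open>n = 1\<close> gives a binary
  form for \<open>PRS\<close>, a larger \<open>n\<close> congruent to 1 modulo \<open>q - 1\<close>
  gives the word of \<open>PLift\<close>.\<close>

definition lift_poly :: "'x::finite \<Rightarrow> 'x \<Rightarrow> nat \<Rightarrow> 'a::comm_ring_1 set \<Rightarrow> ('x, 'a) mpoly" where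
  "lift_poly i j n A = mpoly_var i ^ n * (\<Prod>a\<in>A. mpoly_var j - mpoly_const a * mpoly_var i)"

lemma mpoly_eval_lift_poly:
  "mpoly_eval (lift_poly i j n A) x = x $ i ^ n * (\<Prod>a\<in>A. x $ j - a * x $ i)"
  by (simp add: lift_poly_def mpoly_eval_hom)

lemma homogeneous_lift_poly:
  "finite A \<Longrightarrow> lift_poly i j n A \<in> homogeneous_polys (n + card A)"
  unfolding lift_poly_def
  by (intro homogeneous_polys_mult homogeneous_polys_power homogeneous_polys_prod
      homogeneous_polys_diff homogeneous_polys_const_mult homogeneous_polys_var)

text \<open>Such vectors lie in a product of coordinate sets with one element at \<open>i\<close>,
  the set \<open>B\<close> at \<open>j\<close>, and the whole field elsewhere.\<close>

lemma card_vec_two_coords: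
  fixes B :: "'a::{finite,one} set" and i j :: "'x::finite"
  assumes "i \<noteq> j"
  shows "card {x :: 'a ^ 'x. x $ i = 1 \<and> x $ j \<in> B} \<le> card B * CARD('a) ^ (CARD('x) - 2)"
proof -
  define F where "F = (\<lambda>l. if l = i then {1} else if l = j then B else UNIV)"
  have "{x :: 'a ^ 'x. x $ i = 1 \<and> x $ j \<in> B} \<subseteq> vec_lambda ` PiE UNIV F"
  proof
    fix x :: "'a ^ 'x" assume x: "x \<in> {x. x $ i = 1 \<and> x $ j \<in> B}"
    have "x = vec_lambda (vec_nth x)" by simp
    moreover have "vec_nth x \<in> PiE UNIV F" using x by (auto simp: F_def)
    ultimately show "x \<in> vec_lambda ` PiE UNIV F" by (rule image_eqI)
  qed
  then have "card {x :: 'a ^ 'x. x $ i = 1 \<and> x $ j \<in> B} \<le> card (PiE UNIV F)"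
    by (rule surj_card_le[rotated]) simp
  also have "\<dots> = (\<Prod>l\<in>insert i (insert j (UNIV - {i, j})). card (F l))"
    by (subst card_PiE) (auto intro: prod.cong)
  also have "\<dots> = card B * (\<Prod>l\<in>UNIV - {i, j}. card (F l))"
    using assms by (simp add: F_def)
  also have "(\<Prod>l\<in>UNIV - {i, j}. card (F l)) = (\<Prod>l\<in>UNIV - {i, j}. CARD('a))"
    by (intro prod.cong) (auto simp: F_def)
  also have "\<dots> = CARD('a) ^ (CARD('x) - 2)"
    using assms by (simp add: card_Diff_subset numeral_2_eq_2)
  finally show ?thesis .
qed

text \<open>Where the form does not vanish, the coordinate at the least index \<open>i\<close> is
  nonzero and hence 1 by normalization; the linear factors then say that the coordinate at
  \<open>j\<close> avoids \<open>A\<close>.\<close>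

lemma lift_poly_weight_le:
  fixes A :: "'a::{field,finite} set" and i j :: "'x::{finite,linorder}"
  assumes "i \<noteq> j" "\<And>l. i \<le> l" "n > 0"
  shows "hamming_dist proj_space (ev_proj (lift_poly i j n A)) (ev_proj 0)
    \<le> (CARD('a) - card A) * CARD('a) ^ (CARD('x) - 2)"
proof -
  have "{x \<in> proj_normalized. mpoly_eval (lift_poly i j n A) x \<noteq> mpoly_eval 0 x}
      \<subseteq> {x. x $ i = 1 \<and> x $ j \<in> - A}"
  proof
    fix x assume x: "x \<in> {x \<in> proj_normalized. mpoly_eval (lift_poly i j n A) x \<noteq> mpoly_eval 0 x}"
    then have xi: "x $ i \<noteq> 0" and xj: "\<forall>a\<in>A. x $ j \<noteq> a * x $ i"
      using assms(3) by (auto simp: mpoly_eval_lift_poly)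
    obtain l where l: "x $ l = 1" "\<forall>j<l. x $ j = 0"
      using x by (auto simp: proj_normalized_def)
    have "l = i" using l xi assms(2)[of l] by (metis order_le_less)
    then show "x \<in> {x. x $ i = 1 \<and> x $ j \<in> - A}" using l xj by auto
  qed
  then have "hamming_dist proj_space (ev_proj (lift_poly i j n A)) (ev_proj 0)
      \<le> card {x :: ('a, 'x) vec. x $ i = 1 \<and> x $ j \<in> - A}"
    unfolding hamming_dist_ev_proj by (intro card_mono) auto
  also have "\<dots> \<le> card (- A) * CARD('a) ^ (CARD('x) - 2)"
    by (rule card_vec_two_coords[OF assms(1)])
  finally show ?thesis by (simp add: Compl_eq_Diff_UNIV card_Diff_subset)
qed

lemma ev_proj_lift_poly_nonzero:
  fixes A :: "'a::{field,finite} set" and i j :: "'x::{finite,linorder}"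
  assumes "i \<noteq> j" "\<And>l. i \<le> l" "card A < CARD('a)"
  shows "ev_proj (lift_poly i j n A) \<noteq> ev_proj 0"
proof -
  have "A \<noteq> UNIV" using assms(3) by auto
  \<comment> \<open>With 1 at \<open>i\<close> and \<open>b\<close> at \<open>j\<close>, every
    linear factor takes a value \<open>b - a\<close>, which is nonzero.\<close>
  then obtain b where b: "b \<notin> A" by auto
  define x :: "('a, 'x) vec" where "x = (\<chi> l. if l = i then 1 else if l = j then b else 0)"
  have "x \<in> proj_normalized"
    using assms(2) by (auto simp: proj_normalized_def x_def not_less[symmetric] intro!: exI[of _ i])
  moreover have "mpoly_eval (lift_poly i j n A) x \<noteq> mpoly_eval 0 x"
    using b assms(1) by (auto simp: mpoly_eval_lift_poly x_def)
  ultimately show ?thesis unfolding ev_proj_eq_iff by blast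
qed

lemma zero_mem_PRS: "ev_proj 0 \<in> PRS k"
  unfolding PRS_def by (intro CollectI exI conjI) (rule refl, simp)

lemma zero_mem_PLift: "ev_proj 0 \<in> PLift k"
  unfolding PLift_def Let_def
  by (intro CollectI exI[of _ 0])
     (simp add: mpoly_comp_linear_def mpoly_subst_def zero_mem_PRS)

text \<open>Membership in \<open>PRS\<close> concerns values only, so on each line the power
  \<open>?n\<close> may be replaced by 1, which lowers the degree to \<open>k\<close>.\<close>

lemma lift_poly_mem_PLift:
  fixes A :: "'a::{field,finite} set" and i j :: "'x::{finite,linorder}"
  assumes "k = Suc (card A)"
  shows "ev_proj (lift_poly i j (Suc ((CARD('x) - 2) * (CARD('a) - 1))) A) \<in> PLift k"
proof -
  let ?n = "Suc ((CARD('x) - 2) * (CARD('a) - 1))"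
  \<comment> \<open>The exponent is 1 modulo \<open>CARD('a) - 1\<close>, and being positive it also
    fits \<open>x = 0\<close>.\<close>
  have pow: "x ^ ?n = x" for x :: 'a
  proof (cases "x = 0")
    case False
    have "x ^ ?n = x * (x ^ (CARD('a) - 1)) ^ (CARD('x) - 2)"
      by (simp add: power_mult[symmetric] mult.commute)
    also have "x ^ (CARD('a) - 1) = 1" using False by (rule finite_field_power_card_minus_1)
    finally show ?thesis by simp
  qed simp
  \<comment> \<open>The \<open>Suc\<close> in \<open>?n\<close> supplies the one degree by which
    \<open>k\<close> exceeds \<open>card A\<close>.\<close>
  have hom: "lift_poly i j ?n A \<in> homogeneous_polys (k + (CARD('x) - 1 - 1) * (CARD('a) - 1))"
    using homogeneous_lift_poly[of A i j ?n] assms by (simp add: add.commute numeral_2_eq_2)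
  have "ev_proj (mpoly_comp_linear (lift_poly i j ?n A) L) \<in> PRS k"
    if "L \<in> Emb_proj" for L :: "'a ^ 2 \<Rightarrow> ('a, 'x) vec"
  proof -
    have lin: "Vector_Spaces.linear (*s) (*s) L" using that by (simp add: Emb_proj_def)
    define l where "l r = (\<Sum>s\<in>UNIV. mpoly_const (matrix L $ r $ s) * mpoly_var s)" for r
    \<comment> \<open>This is the form restricted to the line, with \<open>l i\<close> in place of
      its power: a product of \<open>1 + card A = k\<close> linear forms.\<close>
    define g where "g = l i * (\<Prod>a\<in>A. l j - mpoly_const a * l i)"
    have hl: "l r \<in> homogeneous_polys 1" for r
      unfolding l_def
      by (intro homogeneous_polys_sum homogeneous_polys_const_mult homogeneous_polys_var)
    have "g \<in> homogeneous_polys (1 + card A)"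
      unfolding g_def
      by (intro homogeneous_polys_mult homogeneous_polys_prod homogeneous_polys_diff
          homogeneous_polys_const_mult hl) simp
    moreover have "ev_proj (mpoly_comp_linear (lift_poly i j ?n A) L) = ev_proj g"
    proof -
      have "mpoly_eval (l r) y = L y $ r" for r y
        using matrix_works[OF lin, of y, symmetric]
        by (simp add: l_def mpoly_eval_hom matrix_vector_mult_def)
      then show ?thesis
        unfolding ev_proj_eq_iff mpoly_eval_comp_linear[OF lin] mpoly_eval_lift_poly pow
        by (simp add: g_def mpoly_eval_hom)
    qed
    ultimately show ?thesis using assms by (auto simp: PRS_def)
  qed
  then show ?thesis using hom unfolding PLift_def Let_def by blast
qed

section \<open>Binary forms and the projective line\<close>

lemma UNIV_2_eq: "(UNIV :: 2 set) = {0, 1}"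
  by (rule card_eq_UNIV_imp_eq_UNIV[symmetric]) simp_all

text \<open>Provides the least index that the lemmas on \<open>lift_poly\<close> demand of
  \<open>i\<close>.\<close>

lemma two_type_zero_le: "(0 :: 2) \<le> l"
  using Rep_bit0[of l] by (simp add: less_eq_bit0_def bit0.Rep_0)

lemma card_proj_space_2: "card (proj_space :: ('a::{field,finite} ^ 2) set set) = CARD('a) + 1"
proof -
  have "card {0, 1 :: 'a} \<le> CARD('a)" by (rule card_mono) simp_all
  then have "CARD('a) > 1" by simp
  \<comment> \<open>Writing the field size as \<open>r + 2\<close> turns \<open>CARD('a) - 1\<close>
    into the cancellable factor \<open>Suc r\<close>.\<close>
  then obtain r where r: "CARD('a) = Suc (Suc r)" by (metis less_imp_Suc_add add_Suc plus_1_eq_Suc)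
  have "Suc r * card (proj_space :: ('a ^ 2) set set) = Suc r * (CARD('a) + 1)"
    using card_proj_space[where 'a = 'a and 'x = 2] by (simp add: r power2_eq_square)
  then show ?thesis by (metis mult_left_cancel nat.distinct(1))
qed

text \<open>Dehomogenizing on the chart \<open>(1, t)\<close> yields a univariate \<open>p\<close>
  of degree at most \<open>k\<close>, whose roots are the affine zeros. Only the point
  \<open>(0, 1)\<close> remains to be accounted for.\<close>

lemma card_roots_homogeneous_2:
  fixes f :: "(2, 'a::{field,finite}) mpoly"
  assumes f: "f \<in> homogeneous_polys k" and nz: "\<exists>x\<in>proj_normalized. mpoly_eval f x \<noteq> 0"
  shows "card {x \<in> proj_normalized. mpoly_eval f x = 0} \<le> k"
proof -
  define aff :: "'a \<Rightarrow> 'a ^ 2" where "aff t = (\<chi> i. if i = 0 then 1 else t)" for t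
  define inf :: "'a ^ 2" where "inf = (\<chi> i. if i = 0 then 0 else 1)"
  define p where "p = (\<Sum>\<mu>\<in>Poly_Mapping.keys f.
      monom (Poly_Mapping.lookup f \<mu>) (Poly_Mapping.lookup \<mu> 1))"
  have deg: "Poly_Mapping.lookup \<mu> 0 + Poly_Mapping.lookup \<mu> 1 = k" if "\<mu> \<in> Poly_Mapping.keys f" for \<mu>
    using f that by (simp add: homogeneous_polys_def UNIV_2_eq)
  have eval_aff: "mpoly_eval f (aff t) = poly p t" for t
    by (simp add: mpoly_eval_def mpoly_subst_def p_def aff_def UNIV_2_eq poly_sum poly_monom)
  \<comment> \<open>the point at infinity is a zero of \<open>f\<close> exactly when the degree of \<open>p\<close> drops below \<open>k\<close>\<close>
  have eval_inf: "mpoly_eval f inf = coeff p k"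
    unfolding mpoly_eval_def mpoly_subst_def p_def coeff_sum
    using deg by (intro sum.cong) (force simp: inf_def UNIV_2_eq power_0_left)+
  have degree: "degree p \<le> k"
    unfolding p_def
  proof (rule degree_sum_le)
    fix \<mu> assume "\<mu> \<in> Poly_Mapping.keys f"
    then have "Poly_Mapping.lookup \<mu> 1 \<le> k" using deg by (metis le_add2)
    then show "degree (monom (Poly_Mapping.lookup f \<mu>) (Poly_Mapping.lookup \<mu> 1)) \<le> k"
      using degree_monom_le le_trans by blast
  qed simp
  have cases: "x = inf \<or> (\<exists>t. x = aff t)" if "x \<in> proj_normalized" for x
  proof -
    obtain i where i: "x $ i = 1" "\<forall>j<i. x $ j = 0"
      using \<open>x \<in> proj_normalized\<close> by (auto simp: proj_normalized_def)
    show ?thesis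
    proof (cases "i = 0")
      case True
      then have "x = aff (x $ 1)" using i UNIV_2_eq by (auto simp: vec_eq_iff aff_def)
      then show ?thesis by blast
    next
      case False
      then have "i = 1" "0 < i" using UNIV_2_eq two_type_zero_le[of i] by (auto simp: order_less_le)
      then have "x = inf" using i UNIV_2_eq by (auto simp: vec_eq_iff inf_def)
      then show ?thesis by blast
    qed
  qed
  \<comment> \<open>If \<open>p\<close> were zero, \<open>f\<close> would vanish on the whole chart
    and, through the coefficient at \<open>k\<close>, at \<open>inf\<close> as well.\<close>
  have "p \<noteq> 0" using nz cases eval_aff eval_inf by fastforce
  then have roots: "card {t. poly p t = 0} \<le> degree p" by (rule card_poly_roots_bound)
  have sub: "{x \<in> proj_normalized. mpoly_eval f x = 0} \<subseteq>
      aff ` {t. poly p t = 0} \<union> (if coeff p k = 0 then {inf} else {})"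
  proof
    fix x assume "x \<in> {x \<in> proj_normalized. mpoly_eval f x = 0}"
    then have x: "x \<in> proj_normalized" "mpoly_eval f x = 0" by auto
    from cases[OF x(1)] show "x \<in> aff ` {t. poly p t = 0} \<union> (if coeff p k = 0 then {inf} else {})"
      using x(2) eval_aff eval_inf by auto
  qed
  have aff: "card (aff ` {t. poly p t = 0}) \<le> degree p"
    using card_image_le[of "{t. poly p t = 0}" aff] roots by simp
  show ?thesis
  \<comment> \<open>When \<open>inf\<close> is a zero, the degree of \<open>p\<close> is below
    \<open>k\<close>, which makes room for this extra point in the count.\<close>
  proof (cases "coeff p k = 0")
    case True
    then have "degree p < k" using degree \<open>p \<noteq> 0\<close> by (metis le_neq_implies_less leading_coeff_0_iff)
    moreover have "card {x \<in> proj_normalized. mpoly_eval f x = 0} \<le> card (insert inf (aff ` {t. poly p t = 0}))"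
      using sub True by (intro card_mono) auto
    moreover have "card (insert inf (aff ` {t. poly p t = 0})) \<le> Suc (card (aff ` {t. poly p t = 0}))"
      by (rule card_insert_le_m1) simp_all
    ultimately show ?thesis using aff by linarith
  next
    case False
    then have "card {x \<in> proj_normalized. mpoly_eval f x = 0} \<le> card (aff ` {t. poly p t = 0})"
      using sub by (intro card_mono) auto
    then show ?thesis using aff degree by linarith
  qed
qed

text \<open>The difference of the two forms is a form of degree \<open>k\<close> that is not zero on
  every point, so the words agree in at most \<open>k\<close> of the \<open>CARD('a) + 1\<close>
  positions.\<close>

lemma PRS_dist_ge:
  fixes c c' :: "('a::{field,finite} ^ 2) set \<Rightarrow> 'a"
  assumes "c \<in> PRS k" "c' \<in> PRS k" "c \<noteq> c'"
  shows "CARD('a) + 1 - k \<le> hamming_dist proj_space c c'"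
proof -
  obtain f g where f: "f \<in> homogeneous_polys k" "c = ev_proj f"
    and g: "g \<in> homogeneous_polys k" "c' = ev_proj g"
    using assms by (auto simp: PRS_def)
  let ?N = "proj_normalized :: ('a ^ 2) set"
  have "\<exists>x\<in>?N. mpoly_eval (f - g) x \<noteq> 0"
    using assms(3) f g by (simp add: ev_proj_eq_iff mpoly_eval_diff)
  then have "card {x \<in> ?N. mpoly_eval f x = mpoly_eval g x} \<le> k"
    using card_roots_homogeneous_2[OF homogeneous_polys_diff[OF f(1) g(1)]] by (simp add: mpoly_eval_diff)
  moreover have "card ?N = CARD('a) + 1"
    using bij_betw_same_card[OF bij_betw_std_rep] card_proj_space_2 by metis
  moreover have "card ?N = card {x \<in> ?N. mpoly_eval f x \<noteq> mpoly_eval g x} +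
      card {x \<in> ?N. mpoly_eval f x = mpoly_eval g x}"
    by (subst card_Un_disjoint[symmetric]) (auto intro!: arg_cong[of _ _ card])
  ultimately show ?thesis by (simp add: f g hamming_dist_ev_proj)
qed

section \<open>Minimum distances of the two codes\<close>

text \<open>The root bound gives one inequality. For the other, \<open>lift_poly\<close> with
  exponent 1 and \<open>k - 1\<close> field elements has weight at most
  \<open>CARD('a) - (k - 1)\<close>, as two coordinates leave none free.\<close>

lemma min_distance_PRS:
  assumes "1 \<le> k" "k \<le> CARD('a)"
  shows "min_distance proj_space (PRS k :: (('a::{field,finite} ^ 2) set \<Rightarrow> 'a) set) = CARD('a) + 1 - k"
proof -
  obtain A :: "'a set" where A: "card A = k - 1"
    using obtain_subset_with_card_n[of "k - 1" UNIV] assms by (metis diff_le_self le_trans)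
  let ?f = "lift_poly (0::2) 1 1 A"
  have mem: "ev_proj ?f \<in> PRS k"
    using homogeneous_lift_poly[of A "0::2" 1 1] A assms by (auto simp: PRS_def)
  have ne: "ev_proj ?f \<noteq> ev_proj 0"
    by (rule ev_proj_lift_poly_nonzero) (use A assms two_type_zero_le in auto)
  have "min_distance proj_space (PRS k :: (('a ^ 2) set \<Rightarrow> 'a) set) \<le> hamming_dist proj_space (ev_proj ?f) (ev_proj 0)"
    by (rule min_distance_le[OF _ mem zero_mem_PRS ne]) simp
  also have "\<dots> \<le> (CARD('a) - card A) * CARD('a) ^ (CARD(2) - 2)"
    by (rule lift_poly_weight_le) (use two_type_zero_le in auto)
  also have "\<dots> = CARD('a) + 1 - k" using A assms by simp
  finally show ?thesis
    using min_distance_ge[OF _ mem zero_mem_PRS ne PRS_dist_ge] by (intro antisym) simp_all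
qed

lemma min_distance_PLift_le:
  assumes "1 \<le> k" "k \<le> CARD('a)" "CARD('x) \<ge> 2"
  shows "min_distance proj_space (PLift k :: (('a::{field,finite} ^ 'x::{finite,linorder}) set \<Rightarrow> 'a) set)
    \<le> (CARD('a) + 1 - k) * CARD('a) ^ (CARD('x) - 2)"
proof -
  obtain A :: "'a set" where A: "card A = k - 1"
    using obtain_subset_with_card_n[of "k - 1" UNIV] assms by (metis diff_le_self le_trans)
  \<comment> \<open>The standard representative is normalized at its leftmost nonzero coordinate, so
    \<open>i\<close> must be the least index for \<open>x $ i\<close> to be 0 or 1.\<close>
  define i :: 'x where "i = Min UNIV"
  have i: "i \<le> l" for l by (simp add: i_def)
  obtain j where j: "i \<noteq> j"
    using assms(3) by (metis (full_types) card_2_iff' ex_card subset_UNIV)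
  let ?f = "lift_poly i j (Suc ((CARD('x) - 2) * (CARD('a) - 1))) A"
  have "min_distance proj_space (PLift k :: (('a, 'x) vec set \<Rightarrow> 'a) set) \<le> hamming_dist proj_space (ev_proj ?f) (ev_proj 0)"
  proof (rule min_distance_le[OF _ _ zero_mem_PLift])
    show "ev_proj ?f \<in> PLift k" by (rule lift_poly_mem_PLift) (use A assms in simp)
    show "ev_proj ?f \<noteq> ev_proj 0"
      by (rule ev_proj_lift_poly_nonzero[OF j i]) (use A assms in simp)
  qed simp
  also have "\<dots> \<le> (CARD('a) - card A) * CARD('a) ^ (CARD('x) - 2)"
    by (rule lift_poly_weight_le[OF j i]) simp
  also have "CARD('a) - card A = CARD('a) + 1 - k" using A assms by simp
  finally show ?thesis .
qed

theorem proposition56: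
  fixes q m k d D :: nat and \<theta> \<delta> \<Delta> :: real
  assumes q: "q = CARD('a::{field,finite})"
    and m: "m \<ge> 1" and dim: "CARD('n::{finite,linorder}) = m + 1"
    and k: "1 \<le> k" "k \<le> q - 1"
    and \<theta>: "\<theta> = (real q ^ (m + 1) - 1) / (real q - 1)"
    and d: "d = min_distance proj_space (PRS k :: (('a::{field,finite} ^ 2) set \<Rightarrow> 'a) set)"
    and D: "D = min_distance proj_space (PLift k :: (('a::{field,finite} ^ 'n::{finite,linorder}) set \<Rightarrow> 'a) set)"
    and \<delta>: "\<delta> = relative_distance proj_space (PRS k :: (('a::{field,finite} ^ 2) set \<Rightarrow> 'a) set)"
    and \<Delta>: "\<Delta> = relative_distance proj_space (PLift k :: (('a::{field,finite} ^ 'n::{finite,linorder}) set \<Rightarrow> 'a) set)"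
  shows "d = q + 1 - k
    \<and> real D \<le> \<theta> - real q ^ (m - 1) * (real q + 1 - real d)
    \<and> \<delta> = real d / (real q + 1) \<and> \<Delta> = real D / \<theta>
    \<and> (\<exists>b. 0 \<le> b \<and> b \<le> 1 / real q ^ 2 \<and> \<Delta> \<le> (1 - b) * \<delta> + b)"
proof -
  let ?P = "proj_space :: ('a ^ 'n::{finite,linorder}) set set"
  have "card {0, 1 :: 'a} \<le> CARD('a)" by (rule card_mono) simp_all
  then have q2: "q \<ge> 2" using q by simp
  have dk: "d = q + 1 - k"
    using min_distance_PRS[where 'a = 'a and k = k] k q d by simp
  have Dd: "D \<le> d * q ^ (m - 1)"
    using min_distance_PLift_le[where 'a = 'a and 'x = 'n and k = k] k q D dk dim m
    by (simp add: numeral_2_eq_2)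
  have "(q - 1) * card ?P = q ^ (m + 1) - 1"
    using card_proj_space[where 'a = 'a and 'x = 'n] q dim by simp
  then have "(real q - 1) * real (card ?P) = real q ^ (m + 1) - 1"
    using q2 by (metis (no_types, lifting) of_nat_1 of_nat_diff of_nat_mult of_nat_power one_le_numeral
        one_le_power order_trans)
  then have cardP: "real (card ?P) = \<theta>"
    using q2 by (simp add: \<theta> field_simps)
  have \<delta>': "\<delta> = real d / (real q + 1)"
    by (simp add: \<delta> d relative_distance_def card_proj_space_2 q add.commute)
  have \<Delta>': "\<Delta> = real D / \<theta>"
    by (simp add: \<Delta> D relative_distance_def cardP)
  \<comment> \<open>Here \<open>(q - 1)(q + 1) = q^2 - 1\<close>; dividing the resulting inequality
    by \<open>q - 1\<close> bounds \<open>\<theta>\<close> from below.\<close>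
  have "(real q - 1) * ((real q + 1) * real q ^ (m - 1)) = real q ^ (m + 1) - real q ^ (m - 1)"
    using m by (cases m) (simp_all add: algebra_simps)
  also have "\<dots> \<le> real q ^ (m + 1) - 1" using q2 by simp
  finally have \<theta>_ge: "(real q + 1) * real q ^ (m - 1) \<le> \<theta>"
    using q2 by (simp add: \<theta> field_simps)
  have Dd': "real D \<le> real d * real q ^ (m - 1)"
    using Dd by (metis of_nat_le_iff of_nat_mult of_nat_power)
  \<comment> \<open>The claim rearranges to
    \<open>D + q^(m-1) (q + 1) - q^(m-1) d \<le> \<theta>\<close>, where \<open>D\<close> is at most
    \<open>q^(m-1) d\<close>.\<close>
  then have D_le: "real D \<le> \<theta> - real q ^ (m - 1) * (real q + 1 - real d)"
    using \<theta>_ge by (simp add: algebra_simps)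
  have pos: "(real q + 1) * real q ^ (m - 1) > 0" using q2 by simp
  \<comment> \<open>Numerator and denominator are replaced by their bounds, which share the factor
    \<open>q^(m-1)\<close>.\<close>
  have "\<Delta> \<le> real d * real q ^ (m - 1) / ((real q + 1) * real q ^ (m - 1))"
    unfolding \<Delta>' using Dd' \<theta>_ge pos by (intro frac_le) auto
  also have "\<dots> = \<delta>" using q2 by (simp add: \<delta>')
  finally have "\<Delta> \<le> (1 - 0) * \<delta> + 0" by simp
  then have "\<exists>b. 0 \<le> b \<and> b \<le> 1 / real q ^ 2 \<and> \<Delta> \<le> (1 - b) * \<delta> + b"
    by (intro exI[of _ 0]) simp
  then show ?thesis using dk D_le \<delta>' \<Delta>' by blast
qed

end
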